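(* Let $n\ge1$, $L=2n$, and let $$|\psi\rangle=\sum_{m_1,\dots,m_L}\left[(b^l)^TA^{[m_1]}A^{[m_2]}\cdots A^{[m_L]}b^r\right]|m_1m_2\cdots m_L\rangle$$ be a state given by a site-independent matrix product representation with complex $\chi\times\chi$ matrices $A^{[m]}$, $m=1,\dots,d$, and boundary vectors $b^l,b^r\in\mathbb C^\chi$. Suppose there exist a unitary $\chi\times\chi$ matrix $U$ and a real $\theta$ such that $$(A^{[m]})^T=e^{i\theta}\,U^\dagger A^{[m]}U\quad\text{for all }m,\qquad U^\dagger b^r=b^l,\qquad UU^*=-\mathbb 1$$ (where $U^*$ is the entrywise complex conjugate, so that $U^T=-U$). Let $\rho_{\mathrm{red}}=\mathcal L\mathcal R^T$, where $\mathcal L,\mathcal R$ are the Gram matrices of the bipartition into the two halves $\{1,\dots,n\}$ and $\{n+1,\dots,2n\}$ of equal size. Then every eigenvalue of $\rho_{\mathrm{red}}$ has even multiplicity; in particular every level of the entanglement spectrum of $|\psi\rangle$ at the middle cut is exactly (at least doubly) degenerate, for any finite $n$ and with no assumption on the spectrum of the transfer matrix $\sum_m (A^{[m]})^*\otimes A^{[m]}$.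
   Context: The vectors $|m_1\cdots m_L\rangle$ are the orthonormal product basis of $(\mathbb C^d)^{\otimes L}$. For $\alpha\in\{1,\dots,\chi\}$ define $$|\psi_{\mathcal A}\rangle_\alpha=\sum_{m_1,\dots,m_n}\left[(b^l)^TA^{[m_1]}\cdots A^{[m_n]}\right]_\alpha|m_1\cdots m_n\rangle,\qquad |\psi_{\mathcal B}\rangle_\alpha=\sum_{m_{n+1},\dots,m_{2n}}\left[A^{[m_{n+1}]}\cdots A^{[m_{2n}]}b^r\right]_\alpha|m_{n+1}\cdots m_{2n}\rangle,$$ so that $|\psi\rangle=\sum_\alpha|\psi_{\mathcal A}\rangle_\alpha\otimes|\psi_{\mathcal B}\rangle_\alpha$. The Gram matrices are $\mathcal L_{\alpha\beta}={}_\alpha\langle\psi_{\mathcal A}|\psi_{\mathcal A}\rangle_\beta$ and $\mathcal R_{\alpha\beta}={}_\alpha\langle\psi_{\mathcal B}|\psi_{\mathcal B}\rangle_\beta$. The matrix $\rho_{\mathrm{red}}=\mathcal L\mathcal R^T$ has the same nonzero spectrum as the (unnormalized) reduced density matrix $\mathrm{Tr}_{\mathcal B}|\psi\rangle\langle\psi|$. If $|\psi\rangle\neq0$, the levels of the entanglement spectrum are $-\log$ of the nonzero eigenvalues of the normalized reduced density matrix. *)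

theory Defs
  imports
    "Jordan_Normal_Form.Schur_Decomposition"
    "Jordan_Normal_Form.Char_Poly"
    "HOL-Computational_Algebra.Computational_Algebra"
begin

text \<open>
  The local basis labels are \<open>0, \<dots>, d - 1\<close> and all matrix and vector indices start at \<open>0\<close>.
  The space of \<open>N\<close> sites is identified with vectors of dimension \<open>d ^ N\<close> by ordering the product
  basis lexicographically: basis vector number \<open>i\<close> is labelled by the base-\<open>d\<close> digits of \<open>i\<close>, most
  significant digit (leftmost site) first. With this ordering, the basis vector number
  \<open>i * d ^ k + j\<close> of \<open>n + k\<close> sites is the tensor product of number \<open>i\<close> of the first \<open>n\<close> sites
  and number \<open>j\<close> of the last \<open>k\<close> sites.
\<close>

definition config :: "nat \<Rightarrow> nat \<Rightarrow> nat \<Rightarrow> nat list" where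
  "config d N i = map (\<lambda>k. i div d ^ (N - 1 - k) mod d) [0..<N]"

definition state_of_amplitudes :: "nat \<Rightarrow> nat \<Rightarrow> (nat list \<Rightarrow> complex) \<Rightarrow> complex vec" where
  "state_of_amplitudes d N c = vec (d ^ N) (\<lambda>i. c (config d N i))"

definition braket :: "complex vec \<Rightarrow> complex vec \<Rightarrow> complex" where
  "braket v w = conjugate v \<bullet> w"

definition unitary_mat :: "nat \<Rightarrow> complex mat \<Rightarrow> bool" where
  "unitary_mat n U \<longleftrightarrow> U \<in> carrier_mat n n \<and>
     mat_adjoint U * U = 1\<^sub>m n \<and> U * mat_adjoint U = 1\<^sub>m n"

definition mps_word :: "nat \<Rightarrow> (nat \<Rightarrow> complex mat) \<Rightarrow> nat list \<Rightarrow> complex mat" where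
  "mps_word \<chi> A ms = foldr (\<lambda>m M. A m * M) ms (1\<^sub>m \<chi>)"

definition mps_state ::
  "nat \<Rightarrow> nat \<Rightarrow> nat \<Rightarrow> (nat \<Rightarrow> complex mat) \<Rightarrow> complex vec \<Rightarrow> complex vec \<Rightarrow> complex vec" where
  "mps_state \<chi> d L A bl br =
     state_of_amplitudes d L (\<lambda>ms. bl \<bullet> (mps_word \<chi> A ms *\<^sub>v br))"

definition psi_left ::
  "nat \<Rightarrow> nat \<Rightarrow> nat \<Rightarrow> (nat \<Rightarrow> complex mat) \<Rightarrow> complex vec \<Rightarrow> nat \<Rightarrow> complex vec" where
  "psi_left \<chi> d n A bl \<alpha> =
     state_of_amplitudes d n (\<lambda>ms. bl \<bullet> col (mps_word \<chi> A ms) \<alpha>)"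

definition psi_right ::
  "nat \<Rightarrow> nat \<Rightarrow> nat \<Rightarrow> (nat \<Rightarrow> complex mat) \<Rightarrow> complex vec \<Rightarrow> nat \<Rightarrow> complex vec" where
  "psi_right \<chi> d n A br \<alpha> =
     state_of_amplitudes d n (\<lambda>ms. (mps_word \<chi> A ms *\<^sub>v br) $ \<alpha>)"

definition gram_left ::
  "nat \<Rightarrow> nat \<Rightarrow> nat \<Rightarrow> (nat \<Rightarrow> complex mat) \<Rightarrow> complex vec \<Rightarrow> complex mat" where
  "gram_left \<chi> d n A bl =
     mat \<chi> \<chi> (\<lambda>(\<alpha>, \<beta>). braket (psi_left \<chi> d n A bl \<alpha>) (psi_left \<chi> d n A bl \<beta>))"

definition gram_right ::
  "nat \<Rightarrow> nat \<Rightarrow> nat \<Rightarrow> (nat \<Rightarrow> complex mat) \<Rightarrow> complex vec \<Rightarrow> complex mat" where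
  "gram_right \<chi> d n A br =
     mat \<chi> \<chi> (\<lambda>(\<alpha>, \<beta>). braket (psi_right \<chi> d n A br \<alpha>) (psi_right \<chi> d n A br \<beta>))"

definition rho_red ::
  "nat \<Rightarrow> nat \<Rightarrow> nat \<Rightarrow> (nat \<Rightarrow> complex mat) \<Rightarrow> complex vec \<Rightarrow> complex vec \<Rightarrow> complex mat" where
  "rho_red \<chi> d n A bl br = gram_left \<chi> d n A bl * (gram_right \<chi> d n A br)\<^sup>T"

definition density_mat :: "complex vec \<Rightarrow> complex mat" where
  "density_mat v = mat (dim_vec v) (dim_vec v) (\<lambda>(i, j). v $ i * cnj (v $ j))"

definition partial_trace_right :: "nat \<Rightarrow> nat \<Rightarrow> complex mat \<Rightarrow> complex mat" where
  "partial_trace_right p q M = mat p p (\<lambda>(i, j). \<Sum>k<q. M $$ (i * q + k, j * q + k))"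

definition trace_normalized :: "complex mat \<Rightarrow> complex mat" where
  "trace_normalized M = (1 / (\<Sum>i<dim_row M. M $$ (i, i))) \<cdot>\<^sub>m M"

text \<open>
  The entanglement spectrum, counted with (algebraic) multiplicity, across the cut between the
  first \<open>n\<close> and the last \<open>k\<close> sites. The reduced density matrix is positive semidefinite, so its
  nonzero eigenvalues are positive reals and taking the real part loses nothing.
\<close>

definition entanglement_spectrum :: "nat \<Rightarrow> nat \<Rightarrow> nat \<Rightarrow> complex vec \<Rightarrow> real multiset" where
  "entanglement_spectrum d n k v =
     image_mset (\<lambda>x. - ln (Re x))
       (filter_mset (\<lambda>x. x \<noteq> 0)
         (proots (char_poly
           (trace_normalized (partial_trace_right (d ^ n) (d ^ k) (density_mat v))))))"

end

theory Submission
  imports Defs "Jordan_Normal_Form.Jordan_Normal_Form_Existence"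
begin

text \<open>
  Transposing a matrix product reverses the word, so the symmetry turns the left amplitudes of a
  word into the right amplitudes of the reversed word, up to a phase and the antisymmetric matrix
  \<open>X = U\<^sup>*\<close>. Hence, with \<open>P\<close> and \<open>Q\<close> the matrices of left and right amplitudes, the coefficient
  matrix \<open>\<Psi> = P Q\<close> of the state is, up to a permutation of its rows and a phase, the antisymmetric
  matrix \<open>M = Q\<^sup>T X Q\<close>. Cyclic permutation of factors does not change nonzero eigenvalues, so both
  \<open>\<rho>\<^sub>r\<^sub>e\<^sub>d = P\<^sup>\<dagger> P Q Q\<^sup>\<dagger>\<close> and the reduced density matrix \<open>\<Psi> \<Psi>\<^sup>\<dagger>\<close> have the nonzero spectrum
  of \<open>M\<^sup>\<dagger> M\<close>, a product of two antisymmetric matrices.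

  A nonzero eigenvalue of a product \<open>N M\<close> of antisymmetric matrices has even multiplicity: in a
  Jordan basis, with \<open>T\<close> the Jordan form, \<open>M T = T\<^sup>T M\<close>, so \<open>M\<close> is block diagonal with respect to the
  generalized eigenspaces, and on the one of a nonzero eigenvalue it is invertible and
  antisymmetric. The multiplicity of \<open>0\<close> in \<open>\<rho>\<^sub>r\<^sub>e\<^sub>d\<close> is then even because \<open>\<chi>\<close> is, \<open>X\<close> being
  invertible and antisymmetric.
\<close>

unbundle no fps_syntax

section \<open>Products of antisymmetric matrices\<close>

lemma char_poly_nonzero: "A \<in> carrier_mat n n \<Longrightarrow> char_poly A \<noteq> 0"
  using degree_monic_char_poly[of A n] by force

text \<open>The block matrix \<open>D\<close> becomes block triangular in two ways: column
  operations preserve \<open>det D\<close> and produce the Schur complement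
  \<open>x - A * B\<close>, while row operations cost a factor \<open>x ^ m\<close> and produce
  \<open>x - B * A\<close>.\<close>

lemma X_power_mult_char_poly_swap:
  fixes A B :: "'a :: idom mat"
  assumes A: "A \<in> carrier_mat n m" and B: "B \<in> carrier_mat m n"
  shows "[:0, 1:] ^ m * char_poly (A * B) = [:0, 1:] ^ n * char_poly (B * A)"
proof -
  let ?x = "[:0, 1:] :: 'a poly"
  let ?c = "map_mat (\<lambda>a. [:a:]) :: 'a mat \<Rightarrow> 'a poly mat"
  define D where "D = four_block_mat (?x \<cdot>\<^sub>m 1\<^sub>m n) (?c A) (?c B) (1\<^sub>m m)"
  have cA: "?c A \<in> carrier_mat n m" and cB: "?c B \<in> carrier_mat m n" using A B by auto
  have DC: "D \<in> carrier_mat (n + m) (n + m)"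
    unfolding D_def by (rule four_block_carrier_mat) auto
  have cp1: "char_poly_matrix (A * B) = ?x \<cdot>\<^sub>m 1\<^sub>m n + ?c A * - ?c B"
    unfolding char_poly_matrix_def using A B
    by (intro eq_matI) (auto simp: map_poly_mult[OF A B, symmetric] one_poly_def)
  have cp2: "char_poly_matrix (B * A) = - (?c B) * ?c A + ?x \<cdot>\<^sub>m 1\<^sub>m m"
    unfolding char_poly_matrix_def using A B
    by (intro eq_matI) (auto simp: map_poly_mult[OF B A, symmetric] one_poly_def)
  have "D * four_block_mat (1\<^sub>m n) (0\<^sub>m n m) (- ?c B) (1\<^sub>m m) =
      four_block_mat (char_poly_matrix (A * B)) (?c A) (0\<^sub>m m n) (1\<^sub>m m)"
    unfolding D_def cp1
    by (subst mult_four_block_mat[of _ n n _ m _ m _ _ n _ m], insert cA cB, auto)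
  moreover have "det (D * four_block_mat (1\<^sub>m n) (0\<^sub>m n m) (- ?c B) (1\<^sub>m m)) = det D"
    by (subst det_mult[OF DC], use cB in simp, subst det_four_block_mat_upper_right_zero[of _ n _ m])
      (use cB in auto)
  ultimately have 1: "det D = char_poly (A * B)"
    using A B cA by (simp add: char_poly_def det_four_block_mat_lower_left_zero[of _ n _ m])
  have "- ?c B * (?x \<cdot>\<^sub>m 1\<^sub>m n) = - (?x \<cdot>\<^sub>m ?c B)"
    using cB by (subst mult_smult_distrib[of _ m n]) (auto intro!: eq_matI)
  moreover have "(?x \<cdot>\<^sub>m 1\<^sub>m m) * ?c B = ?x \<cdot>\<^sub>m ?c B"
    using cB by (subst mult_smult_assoc_mat[of _ m m]) auto
  ultimately have z: "- ?c B * (?x \<cdot>\<^sub>m 1\<^sub>m n) + (?x \<cdot>\<^sub>m 1\<^sub>m m) * ?c B = 0\<^sub>m m n"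
    using cB by (auto intro!: eq_matI)
  have "four_block_mat (1\<^sub>m n) (0\<^sub>m n m) (- ?c B) (?x \<cdot>\<^sub>m 1\<^sub>m m) * D =
      four_block_mat (?x \<cdot>\<^sub>m 1\<^sub>m n) (?c A) (0\<^sub>m m n) (char_poly_matrix (B * A))"
    unfolding D_def cp2
    by (subst mult_four_block_mat[of _ n n _ m _ m _ _ n _ m], insert cA cB z, auto)
  moreover have "det (four_block_mat (1\<^sub>m n) (0\<^sub>m n m) (- ?c B) (?x \<cdot>\<^sub>m 1\<^sub>m m) * D) = ?x ^ m * det D"
    by (subst det_mult[OF _ DC], use cB in simp, subst det_four_block_mat_upper_right_zero[of _ n _ m])
      (use cB in auto)
  ultimately have "?x ^ m * det D = ?x ^ n * char_poly (B * A)"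
    using A B cA by (simp add: char_poly_def det_four_block_mat_lower_left_zero[of _ n _ m])
  then show ?thesis using 1 by simp
qed

text \<open>Powers of the indeterminate affect only the root 0. The rectangular form serves to pass
  between the bond space, of dimension \<chi>, and the half chain, of dimension
  \<open>d ^ n\<close>.\<close>

lemma order_char_poly_swap:
  fixes A B :: "'a :: field mat"
  assumes A: "A \<in> carrier_mat n m" and B: "B \<in> carrier_mat m n" and x: "x \<noteq> 0"
  shows "order x (char_poly (A * B)) = order x (char_poly (B * A))"
proof -
  have nz: "char_poly (A * B) \<noteq> 0" "char_poly (B * A) \<noteq> 0"
    using A B by (auto intro!: char_poly_nonzero)
  have o: "order x ([:0, 1:] ^ k) = 0" for k
    using x by (intro order_0I) (simp add: poly_power)
  have nz2: "[:0, 1:] ^ k \<noteq> (0 :: 'a poly)" for k by simp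
  from arg_cong[OF X_power_mult_char_poly_swap[OF A B], of "order x"] show ?thesis
    using nz nz2 by (simp add: order_mult o del: power_eq_0_iff)
qed

section \<open>Jordan blocks and intertwiners of a triangular matrix with its transpose\<close>

lemma jordan_matrix_nonzero_diag_eq:
  assumes "i < sum_list (map fst n_as)" "j < sum_list (map fst n_as)"
    and "jordan_matrix n_as $$ (i, j) \<noteq> 0"
  shows "jordan_matrix n_as $$ (i, i) = jordan_matrix n_as $$ (j, j)"
  using assms
proof (induct n_as arbitrary: i j)
  case (Cons na n_as)
  obtain n a where na: "na = (n, a)" by force
  show ?case
  proof (cases "i < n"; cases "j < n")
    assume "\<not> i < n" "\<not> j < n"
    then show ?thesis
      using Cons(1)[of "i - n" "j - n"] Cons(2-) by (simp add: na jordan_matrix_Cons)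
  qed (use Cons(2-) in \<open>auto simp: na jordan_matrix_Cons\<close>)
qed simp

text \<open>In entry \<open>(i, j)\<close> of \<open>M * T\<close>, triangularity leaves
  \<open>l \<le> j\<close>; for \<open>l < j\<close> with \<open>T $$ (l, j)\<close> nonzero, the
  diagonal values at \<open>l\<close> and \<open>j\<close> agree, so \<open>M $$ (i, l)\<close>
  vanishes by induction. The other side is symmetric, and only \<open>M $$ (i, j)\<close> times
  either diagonal value remains.\<close>

lemma intertwiner_block_diagonal:
  fixes T M :: "'a :: field mat"
  assumes T: "T \<in> carrier_mat n n" and M: "M \<in> carrier_mat n n"
    and ut: "upper_triangular T"
    and blk: "\<And>i j. i < n \<Longrightarrow> j < n \<Longrightarrow> T $$ (i, j) \<noteq> 0 \<Longrightarrow> T $$ (i, i) = T $$ (j, j)"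
    and comm: "M * T = T\<^sup>T * M"
    and "i < n" "j < n" "T $$ (i, i) \<noteq> T $$ (j, j)"
  shows "M $$ (i, j) = 0"
  using assms(6-)
proof (induct "i + j" arbitrary: i j rule: less_induct)
  case less
  have "(M * T) $$ (i, j) = (\<Sum>l<n. M $$ (i, l) * T $$ (l, j))"
    using T M less by (simp add: scalar_prod_def lessThan_atLeast0)
  also have "\<dots> = (\<Sum>l<n. if l = j then M $$ (i, j) * T $$ (j, j) else 0)"
  proof (rule sum.cong, goal_cases)
    case (2 l)
    consider "l = j" | "l < j" | "j < l" by linarith
    then show ?case
    proof cases
      case 2
      then have "M $$ (i, l) * T $$ (l, j) = 0"
        using blk[of l j] less(1)[of i l] less(2-) by fastforce
      then show ?thesis using 2 by simp
    next
      case 3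
      then show ?thesis using ut T \<open>l \<in> {..<n}\<close> by (auto dest: upper_triangularD)
    qed auto
  qed simp
  finally have 1: "(M * T) $$ (i, j) = M $$ (i, j) * T $$ (j, j)"
    using less by simp
  have "(T\<^sup>T * M) $$ (i, j) = (\<Sum>l<n. T $$ (l, i) * M $$ (l, j))"
    using T M less by (simp add: scalar_prod_def lessThan_atLeast0)
  also have "\<dots> = (\<Sum>l<n. if l = i then T $$ (i, i) * M $$ (i, j) else 0)"
  proof (rule sum.cong, goal_cases)
    case (2 l)
    consider "l = i" | "l < i" | "i < l" by linarith
    then show ?case
    proof cases
      case 2
      then have "T $$ (l, i) * M $$ (l, j) = 0"
        using blk[of l i] less(1)[of l j] less(2-) by fastforce
      then show ?thesis using 2 by simp
    next
      case 3
      then show ?thesis using ut T \<open>l \<in> {..<n}\<close> by (auto dest: upper_triangularD)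
    qed auto
  qed simp
  finally have 2: "(T\<^sup>T * M) $$ (i, j) = T $$ (i, i) * M $$ (i, j)"
    using less by simp
  have "M $$ (i, j) * T $$ (j, j) = M $$ (i, j) * T $$ (i, i)"
    using 1 2 comm by (metis mult.commute)
  then show ?case using less(4) by (metis mult_cancel_left)
qed

lemma antisymmetric_congruence:
  fixes X :: "'a :: comm_ring_1 mat"
  assumes "Q \<in> carrier_mat k n" "X \<in> carrier_mat k k" "X\<^sup>T = - X"
  shows "(Q\<^sup>T * X * Q)\<^sup>T = - (Q\<^sup>T * X * Q)"
proof -
  have "(Q\<^sup>T * X * Q)\<^sup>T = Q\<^sup>T * (X\<^sup>T * Q)"
    using assms(1,2) by (simp add: transpose_mult[of _ n k _ n] transpose_mult[of _ k k _ n])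
  also have "\<dots> = - (Q\<^sup>T * X * Q)"
    using assms by (simp add: assoc_mult_mat[of _ n k _ k _ n])
  finally show ?thesis .
qed

text \<open>The multiplicity of \<open>x\<close> is the size of its diagonal block in the Jordan
  form. On that block \<open>M'\<close> is invertible and antisymmetric, so comparing its
  determinant with that of its transpose forces an even size.\<close>

lemma even_order_char_poly_mult_antisymmetric:
  fixes N M :: "complex mat"
  assumes N: "N \<in> carrier_mat n n" and M: "M \<in> carrier_mat n n"
    and Nt: "N\<^sup>T = - N" and Mt: "M\<^sup>T = - M" and x: "x \<noteq> 0"
  shows "even (order x (char_poly (N * M)))"
proof -
  have NM: "N * M \<in> carrier_mat n n" using N M by simp
  obtain as where "char_poly (N * M) = (\<Prod>a\<leftarrow>as. [:- a, 1:])"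
    using char_poly_factorized[OF NM] by auto
  then obtain n_as where "jordan_nf (N * M) n_as" using jordan_nf_exists[OF NM] by blast
  define T where "T = jordan_matrix n_as"
  obtain P Q where sim: "similar_mat_wit (N * M) T P Q"
    using \<open>jordan_nf (N * M) n_as\<close> unfolding jordan_nf_def similar_mat_def T_def by auto
  then have C: "T \<in> carrier_mat n n" "P \<in> carrier_mat n n" "Q \<in> carrier_mat n n"
    and PQ: "P * Q = 1\<^sub>m n" and QP: "Q * P = 1\<^sub>m n" and eq: "N * M = P * T * Q"
    using NM unfolding similar_mat_wit_def Let_def by auto
  have dim: "sum_list (map fst n_as) = n" using C(1) unfolding T_def by auto
  have ut: "upper_triangular T"
    unfolding T_def by (rule upper_triangularI) (simp add: jordan_matrix_upper_triangular)
  have blk: "T $$ (i, i) = T $$ (j, j)" if "i < n" "j < n" "T $$ (i, j) \<noteq> 0" for i j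
    using that jordan_matrix_nonzero_diag_eq[of i n_as j] unfolding T_def dim by auto
  \<comment> \<open>Congruences preserve antisymmetry, and as \<open>P\<close> and \<open>Q\<close>
    are mutually inverse, the inner factors cancel in \<open>N' * M'\<close>, leaving
    \<open>Q * (N * M) * P = T\<close>.\<close>
  define M' where "M' = P\<^sup>T * M * P"
  define N' where "N' = Q * N * Q\<^sup>T"
  have C': "M' \<in> carrier_mat n n" "N' \<in> carrier_mat n n"
    using C N M unfolding M'_def N'_def by auto
  have M't: "M'\<^sup>T = - M'" unfolding M'_def by (rule antisymmetric_congruence[OF C(2) M Mt])
  have N't: "N'\<^sup>T = - N'" unfolding N'_def using antisymmetric_congruence[of "Q\<^sup>T" n n N] C N Nt by simp
  have "N' * M' = Q * N * ((Q\<^sup>T * P\<^sup>T) * (M * P))"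
    using C N M unfolding M'_def N'_def by (simp add: assoc_mult_mat[of _ n n _ n _ n])
  also have "Q\<^sup>T * P\<^sup>T = 1\<^sub>m n"
    using C PQ by (simp add: transpose_mult[of P n n Q n, symmetric])
  also have "Q * N * (1\<^sub>m n * (M * P)) = Q * (N * M) * P"
    using C N M by (simp add: assoc_mult_mat[of _ n n _ n _ n])
  also have "\<dots> = (Q * P) * T * (Q * P)"
    using C N M unfolding eq by (simp add: assoc_mult_mat[of _ n n _ n _ n])
  also have "\<dots> = T" using C unfolding QP by simp
  finally have T: "T = N' * M'" by simp
  \<comment> \<open>Transposing \<open>T = N' * M'\<close> swaps the factors, and their two signs
    cancel.\<close>
  have "T\<^sup>T * M' = M'\<^sup>T * N'\<^sup>T * M'"
    unfolding T using C' by (simp add: transpose_mult[of _ n n _ n])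
  also have "\<dots> = M' * N' * M'"
    unfolding M't N't using C' by simp
  also have "\<dots> = M' * T" using C' by (simp add: T)
  finally have comm: "M' * T = T\<^sup>T * M'" by simp
  have M'0: "M' $$ (i, j) = 0" if "i < n" "j < n" "T $$ (i, i) \<noteq> T $$ (j, j)" for i j
    by (rule intertwiner_block_diagonal[OF C(1) C'(1) ut blk comm that])
  \<comment> \<open>Cutting down to the block of \<open>x\<close> and padding with the identity keeps all matrices of size
    \<open>n\<close>; the sign matrix \<open>F\<close> then carries the parity of the block size.\<close>
  define I where "I = {i. i < n \<and> T $$ (i, i) = x}"
  define restr where "restr A = mat n n (\<lambda>(i, j). if i \<in> I \<and> j \<in> I then A $$ (i, j)
      else if i = j then 1 else 0)" for A :: "complex mat"
  define F where "F = mat n n (\<lambda>(i, j). if i = j then if i \<in> I then - 1 else 1 else (0 :: complex))"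
  have rC: "restr A \<in> carrier_mat n n" for A by (simp add: restr_def)
  have FC: "F \<in> carrier_mat n n" by (simp add: F_def)
  have "restr N' * restr M' = restr T"
  proof (rule eq_matI)
    fix i j assume "i < dim_row (restr T)" "j < dim_col (restr T)"
    then have ij: "i < n" "j < n" by (auto simp: restr_def)
    have "(restr N' * restr M') $$ (i, j) = (\<Sum>l<n. restr N' $$ (i, l) * restr M' $$ (l, j))"
      using ij by (simp add: restr_def scalar_prod_def lessThan_atLeast0)
    also have "\<dots> = restr T $$ (i, j)"
    proof (cases "i \<in> I \<and> j \<in> I")
      case True
      \<comment> \<open>Column \<open>j\<close> of \<open>M'\<close> vanishes outside
        \<open>I\<close>, so the truncation loses nothing.\<close>
      have "(\<Sum>l<n. restr N' $$ (i, l) * restr M' $$ (l, j)) = (\<Sum>l<n. N' $$ (i, l) * M' $$ (l, j))"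
        using True ij M'0[of _ j] by (intro sum.cong) (auto simp: restr_def I_def)
      also have "\<dots> = T $$ (i, j)"
        using ij C' unfolding T by (simp add: scalar_prod_def lessThan_atLeast0)
      finally show ?thesis using True ij by (simp add: restr_def)
    next
      case False
      \<comment> \<open>Off the block, row \<open>i\<close> of the first factor or column
        \<open>j\<close> of the second is that of the identity.\<close>
      have "restr N' $$ (i, l) * restr M' $$ (l, j) = (if l = i then if i = j then 1 else 0 else 0)"
        if "l < n" for l
      proof (cases "i \<in> I")
        case True
        then have "j \<notin> I" "i \<noteq> j" using False by auto
        then show ?thesis using True ij that by (cases "l = j") (simp_all add: restr_def)
      next
        case False
        then show ?thesis using ij that by (cases "l = i") (simp_all add: restr_def)
      qed
      then have "(\<Sum>l<n. restr N' $$ (i, l) * restr M' $$ (l, j)) =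
          (\<Sum>l<n. if l = i then if i = j then 1 else 0 else 0)"
        by (intro sum.cong) simp_all
      moreover have "restr T $$ (i, j) = (if i = j then 1 else 0)"
        using False ij by (auto simp: restr_def)
      ultimately show ?thesis using ij by simp
    qed
    finally show "(restr N' * restr M') $$ (i, j) = restr T $$ (i, j)" .
  qed (auto simp: restr_def)
  moreover have "det (restr T) \<noteq> 0"
  proof -
    \<comment> \<open>The diagonal of \<open>restr T\<close> is \<open>x\<close> on \<open>I\<close>
      and 1 elsewhere.\<close>
    have "upper_triangular (restr T)"
      using ut C(1) by (intro upper_triangularI) (auto simp: restr_def dest: upper_triangularD)
    then have "det (restr T) = prod_list (diag_mat (restr T))" 
      using rC by (rule det_upper_triangular)
    also have "\<dots> \<noteq> 0"
      using x by (auto simp: prod_list_zero_iff diag_mat_def restr_def I_def)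
    finally show ?thesis .
  qed
  ultimately have det: "det (restr M') \<noteq> 0"
    using det_mult[OF rC rC, of N' M'] by auto
  have M'a: "M' $$ (j, i) = - M' $$ (i, j)" if "i < n" "j < n" for i j
    using arg_cong[OF M't, of "\<lambda>A. A $$ (i, j)"] that C' by simp
  \<comment> \<open>Transposition negates the block on \<open>I\<close> and fixes the identity
    padding; \<open>F\<close> does the same by scaling rows.\<close>
  have "(restr M')\<^sup>T = F * restr M'"
  proof (rule eq_matI)
    fix i j assume "i < dim_row (F * restr M')" "j < dim_col (F * restr M')"
    then have ij: "i < n" "j < n" by (auto simp: restr_def F_def)
    have "(F * restr M') $$ (i, j) = (\<Sum>l<n. F $$ (i, l) * restr M' $$ (l, j))"
      using ij by (simp add: F_def restr_def scalar_prod_def lessThan_atLeast0)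
    also have "\<dots> = (\<Sum>l<n. if l = i then (if i \<in> I then - 1 else 1) * restr M' $$ (i, j) else 0)"
      using ij by (intro sum.cong) (auto simp: F_def)
    also have "\<dots> = restr M' $$ (j, i)"
      using ij M'a[of i j] by (auto simp: restr_def)
    finally show "(restr M')\<^sup>T $$ (i, j) = (F * restr M') $$ (i, j)"
      using ij by (simp add: restr_def)
  qed (auto simp: restr_def F_def)
  then have "det F * det (restr M') = det (restr M')"
    using det_mult[OF FC rC] det_transpose[OF rC] by metis
  then have "det F = 1" using det by simp
  moreover have "det F = (-1) ^ card I"
  proof -
    have "det F = prod_list (diag_mat F)"
      by (rule det_upper_triangular[OF _ FC]) (auto simp: F_def)
    also have "\<dots> = (\<Prod>i<n. if i \<in> I then - 1 else 1)"
      by (simp add: diag_mat_def F_def prod.list_conv_set_nth lessThan_atLeast0)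
    also have "\<dots> = (\<Prod>i\<in>{..<n} \<inter> I. - 1)"
      by (rule prod.inter_restrict[symmetric]) simp
    also have "{..<n} \<inter> I = I" by (auto simp: I_def)
    finally show ?thesis by simp
  qed
  ultimately have "even (card I)" by (metis one_neq_neg_one neg_one_odd_power)
  moreover have "order x (char_poly (N * M)) = card I"
  proof -
    have "char_poly (N * M) = (\<Prod>a\<leftarrow>diag_mat T. [:- a, 1:])"
      using sim char_poly_similar char_poly_upper_triangular[OF C(1) ut]
      unfolding similar_mat_def by metis
    moreover have "proots (\<Prod>a\<leftarrow>xs. [:- a, 1:]) = mset xs" for xs :: "complex list"
    proof (induct xs)
      case (Cons a xs)
      have "(\<Prod>a\<leftarrow>xs. [:- a, 1:]) \<noteq> 0" by (auto simp: prod_list_zero_iff)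
      then have "proots ([:- a, 1:] * (\<Prod>a\<leftarrow>xs. [:- a, 1:])) = mset (a # xs)"
        using Cons by (subst proots_mult) auto
      then show ?case by simp
    qed simp
    ultimately have "proots (char_poly (N * M)) = mset (diag_mat T)" by simp
    moreover have "char_poly (N * M) \<noteq> 0"
      using char_poly_nonzero[OF NM] .
    ultimately have "order x (char_poly (N * M)) = count (mset (diag_mat T)) x"
      by (metis count_proots)
    also have "\<dots> = card I"
      using C(1) by (simp add: diag_mat_def I_def count_image_mset_eq_card_vimage)
    finally show ?thesis .
  qed
  ultimately show ?thesis by simp
qed

section \<open>Parity and counting of roots\<close>

lemma even_dim_invertible_antisymmetric:
  fixes X :: "complex mat"
  assumes X: "X \<in> carrier_mat n n" and Xt: "X\<^sup>T = - X" and det: "det X \<noteq> 0"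
  shows "even n"
proof -
  have "- X = (- 1) \<cdot>\<^sub>m X" using X by (intro eq_matI) auto
  then have "det X = (- 1) ^ n * det X"
    using det_transpose[OF X] X unfolding Xt by (simp add: det_smult)
  then have "(- 1 :: complex) ^ n = 1" using det by simp
  then show ?thesis by (metis one_neq_neg_one neg_one_odd_power)
qed

text \<open>Over the complex numbers the orders of the roots add up to the degree, so the order of 0
  inherits its parity.\<close>

lemma even_order_from_nonzero_roots:
  fixes p :: "complex poly"
  assumes p: "p \<noteq> 0" and deg: "even (degree p)"
    and nonzero: "\<And>x. x \<noteq> 0 \<Longrightarrow> even (order x p)"
  shows "even (order x p)"
proof (cases "x = 0")
  case True
  have "degree p = (\<Sum>y\<in>set_mset (proots p). order y p)"
    using p by (simp add: size_proots_complex[symmetric] size_multiset_overloaded_eq)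
  \<comment> \<open>Inserting 0 is harmless: if it is not a root, its order is 0.\<close>
  also have "\<dots> = (\<Sum>y\<in>insert 0 (set_mset (proots p)). order y p)"
    by (rule sum.mono_neutral_left) (use p in \<open>auto simp flip: count_proots simp: count_eq_zero_iff poly_roots_finite\<close>)
  also have "\<dots> = order 0 p + (\<Sum>y\<in>set_mset (proots p) - {0}. order y p)"
    by (rule sum.insert_remove) simp
  finally have "even (order 0 p + (\<Sum>y\<in>set_mset (proots p) - {0}. order y p))"
    using deg by simp
  moreover have "even (\<Sum>y\<in>set_mset (proots p) - {0}. order y p)"
    by (rule dvd_sum) (use nonzero in auto)
  ultimately show ?thesis using True by simp
qed (use nonzero in auto)

text \<open>A positive even order is at least 2, so two copies of a root map to \<open>y\<close>;
  collisions of \<open>f\<close> can only raise the count.\<close>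

lemma two_le_count_image_mset_nonzero_proots:
  fixes p :: "complex poly"
  assumes p: "p \<noteq> 0" and nonzero: "\<And>x. x \<noteq> 0 \<Longrightarrow> even (order x p)"
    and y: "y \<in># image_mset f (filter_mset (\<lambda>x. x \<noteq> 0) (proots p))"
  shows "2 \<le> count (image_mset f (filter_mset (\<lambda>x. x \<noteq> 0) (proots p))) y"
proof -
  obtain x where x: "x \<noteq> 0" "x \<in># proots p" "y = f x" using y by auto
  then have "0 < order x p" using p by (simp flip: count_proots add: count_greater_zero_iff)
  moreover have "even (order x p)" using nonzero x(1) .
  ultimately have "2 \<le> order x p" by presburger
  then have "{#x, x#} \<subseteq># filter_mset (\<lambda>x. x \<noteq> 0) (proots p)"
    using x(1) p by (intro mset_subset_eqI) auto
  then have "{#y, y#} \<subseteq># image_mset f (filter_mset (\<lambda>x. x \<noteq> 0) (proots p))"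
    using image_mset_subseteq_mono[of "{#x, x#}" _ f] x(3) by simp
  from mset_subset_eq_count[OF this, of y] show ?thesis by simp
qed

section \<open>Gram matrices\<close>

lemma mat_adjoint_eq_transpose_cnj: "mat_adjoint A = (map_mat cnj A)\<^sup>T"
  unfolding mat_adjoint_def
  by (rule eq_matI) (auto simp: mat_of_rows_def cols_def conjugate_complex_def)

lemma mat_adjoint_carrier: "A \<in> carrier_mat n m \<Longrightarrow> mat_adjoint (A :: complex mat) \<in> carrier_mat m n"
  by (simp add: mat_adjoint_eq_transpose_cnj)

lemma index_mat_adjoint_mult:
  assumes "A \<in> carrier_mat n m" "B \<in> carrier_mat n k" "i < m" "j < k"
  shows "(mat_adjoint A * B) $$ (i, j) = (\<Sum>l<n. cnj (A $$ (l, i)) * B $$ (l, j))"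
  using assms by (simp add: mat_adjoint_eq_transpose_cnj scalar_prod_def lessThan_atLeast0)

lemma index_mult_mat_adjoint:
  assumes "A \<in> carrier_mat n m" "B \<in> carrier_mat k m" "i < n" "j < k"
  shows "(A * mat_adjoint B) $$ (i, j) = (\<Sum>l<m. A $$ (i, l) * cnj (B $$ (j, l)))"
  using assms by (simp add: mat_adjoint_eq_transpose_cnj scalar_prod_def lessThan_atLeast0)

lemma mat_adjoint_mult:
  assumes "A \<in> carrier_mat n m" "B \<in> carrier_mat m k"
  shows "mat_adjoint (A * B) = mat_adjoint B * mat_adjoint (A :: complex mat)"
proof (rule eq_matI)
  fix i j assume "i < dim_row (mat_adjoint B * mat_adjoint A)" "j < dim_col (mat_adjoint B * mat_adjoint A)"
  with assms show "mat_adjoint (A * B) $$ (i, j) = (mat_adjoint B * mat_adjoint A) $$ (i, j)"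
    by (simp add: mat_adjoint_eq_transpose_cnj scalar_prod_def mult.commute)
qed (use assms in \<open>auto simp: mat_adjoint_eq_transpose_cnj\<close>)

lemma gram_mult:
  assumes B: "B \<in> carrier_mat n k" and C: "C \<in> carrier_mat k l"
  shows "mat_adjoint (B * C) * (B * C) = mat_adjoint C * (mat_adjoint B * B) * (C :: complex mat)"
  using B C mat_adjoint_carrier[OF B] mat_adjoint_carrier[OF C]
  by (simp add: mat_adjoint_mult[OF B C] assoc_mult_mat[of _ l k _ n _ l]
      assoc_mult_mat[of _ k n _ k _ l] assoc_mult_mat[of _ l k _ k _ l])

text \<open>The phase cancels against its conjugate, and the permutation reindexes the sum over
  rows.\<close>

lemma gram_phase_permuted_rows:
  assumes A: "A \<in> carrier_mat n k" and B: "B \<in> carrier_mat n k"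
    and \<sigma>: "bij_betw \<sigma> {..<n} {..<n}" and c: "cmod c = 1"
    and eq: "\<And>i j. i < n \<Longrightarrow> j < k \<Longrightarrow> B $$ (i, j) = c * A $$ (\<sigma> i, j)"
  shows "mat_adjoint B * B = mat_adjoint A * A"
proof (rule eq_matI)
  fix i j assume "i < dim_row (mat_adjoint A * A)" "j < dim_col (mat_adjoint A * A)"
  then have ij: "i < k" "j < k" using A mat_adjoint_carrier[OF A] by auto
  have cc: "cnj c * c = 1" using complex_norm_square[of c] c by (simp add: mult.commute)
  have "(mat_adjoint B * B) $$ (i, j) = (\<Sum>l<n. cnj (A $$ (\<sigma> l, i)) * A $$ (\<sigma> l, j))"
    unfolding index_mat_adjoint_mult[OF B B ij]
  proof (rule sum.cong)
    fix l assume "l \<in> {..<n}"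
    then have "cnj (B $$ (l, i)) * B $$ (l, j) =
        (cnj c * c) * (cnj (A $$ (\<sigma> l, i)) * A $$ (\<sigma> l, j))"
      using ij by (simp add: eq)
    then show "cnj (B $$ (l, i)) * B $$ (l, j) = cnj (A $$ (\<sigma> l, i)) * A $$ (\<sigma> l, j)"
      unfolding cc by simp
  qed simp
  also have "\<dots> = (\<Sum>l<n. cnj (A $$ (l, i)) * A $$ (l, j))"
    by (rule sum.reindex_bij_betw[OF \<sigma>])
  finally show "(mat_adjoint B * B) $$ (i, j) = (mat_adjoint A * A) $$ (i, j)"
    unfolding index_mat_adjoint_mult[OF A A ij] .
qed (use A B in \<open>auto simp: mat_adjoint_eq_transpose_cnj\<close>)

section \<open>Matrix product states\<close>

lemma length_config [simp]: "length (config d n i) = n"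
  by (simp add: config_def)

lemma nth_config: "t < n \<Longrightarrow> config d n i ! t = i div d ^ (n - 1 - t) mod d"
  by (simp add: config_def)

text \<open>Concatenating words means tensoring basis vectors. Division by \<open>d ^ k\<close>
  recovers \<open>i\<close>, while the last \<open>k\<close> digits do not see \<open>i\<close>,
  since \<open>i * d ^ k\<close> divided by \<open>d ^ e\<close> with \<open>e < k\<close> is still
  a multiple of \<open>d\<close>.\<close>

lemma config_append:
  assumes j: "j < d ^ k"
  shows "config d (n + k) (i * d ^ k + j) = config d n i @ config d k j"
proof (rule nth_equalityI)
  fix t assume "t < length (config d (n + k) (i * d ^ k + j))"
  then have t: "t < n + k" by (simp add: config_def)
  show "config d (n + k) (i * d ^ k + j) ! t = (config d n i @ config d k j) ! t"
  proof (cases "t < n")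
    case True
    have "d ^ (n + k - 1 - t) = d ^ k * d ^ (n - 1 - t)"
      using True by (simp add: add.commute flip: power_add)
    moreover have "(i * d ^ k + j) div d ^ k = i"
      using gr_implies_not0[OF j] j by (metis add.right_neutral div_less div_mult_self3)
    ultimately show ?thesis using True
      by (simp add: config_def nth_append div_mult2_eq)
  next
    case False
    define e where "e = n + k - 1 - t"
    have e: "e < k" "e = k - 1 - (t - n)" using False t unfolding e_def by auto
    have d: "d > 0" using e(1) j by (cases d) (auto simp: power_0_left)
    have "d ^ k = d ^ (k - e - 1) * d * d ^ e"
    proof -
      have "k = (k - e - 1) + 1 + e" using e(1) by simp
      then show ?thesis by (metis power_add power_one_right)
    qed
    then have "(i * d ^ k + j) div d ^ e = i * d ^ (k - e - 1) * d + j div d ^ e"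
      using d by (simp add: mult.assoc[symmetric])
    then have "(i * d ^ k + j) div d ^ e mod d = j div d ^ e mod d" by simp
    moreover have "config d (n + k) (i * d ^ k + j) ! t = (i * d ^ k + j) div d ^ e mod d"
      using t by (simp only: nth_config e_def)
    moreover have "(config d n i @ config d k j) ! t = j div d ^ e mod d"
      using False t by (simp add: nth_append nth_config e(2))
    ultimately show ?thesis by simp
  qed
qed (simp add: config_def)

text \<open>Surjectivity is by prepending letters; injectivity then follows by counting, as there
  are \<open>d ^ n\<close> words.\<close>

lemma bij_betw_config:
  "bij_betw (config d n) {..<d ^ n} {ms. set ms \<subseteq> {..<d} \<and> length ms = n}"
proof -
  have sub: "config d n ` {..<d ^ n} \<subseteq> {ms. set ms \<subseteq> {..<d} \<and> length ms = n}"
    by (cases "d = 0"; cases "n = 0") (auto simp: config_def power_0_left)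
  have surj: "ms \<in> config d (length ms) ` {..<d ^ length ms}" if "set ms \<subseteq> {..<d}" for ms
    using that
  proof (induct ms)
    case Nil
    then show ?case by (simp add: config_def)
  next
    case (Cons m ms)
    then obtain j where j: "j < d ^ length ms" "config d (length ms) j = ms" by force
    have m: "m < d" using Cons by simp
    have "config d (1 + length ms) (m * d ^ length ms + j) = m # ms"
      unfolding config_append[OF j(1)] j(2) using m by (simp add: config_def)
    moreover have "m * d ^ length ms + j < d ^ length (m # ms)"
      using mult_right_mono[of "Suc m" d "d ^ length ms"] m j(1) by simp
    ultimately show ?case by (metis imageI lessThan_iff length_Cons plus_1_eq_Suc)
  qed
  have img: "config d n ` {..<d ^ n} = {ms. set ms \<subseteq> {..<d} \<and> length ms = n}"
    using sub surj by auto
  then have "card (config d n ` {..<d ^ n}) = card {..<d ^ n}"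
    by (simp add: card_lists_length_eq)
  then have "inj_on (config d n) {..<d ^ n}" by (rule eq_card_imp_inj_on[rotated]) simp
  then show ?thesis using img by (rule bij_betw_imageI)
qed

text \<open>Reflecting the half chain permutes its product basis: \<sigma> is \<open>rev\<close>
  transported along the digit bijection.\<close>

lemma config_rev_permutation:
  obtains \<sigma> where "bij_betw \<sigma> {..<d ^ n} {..<d ^ n}"
    "\<And>i. i < d ^ n \<Longrightarrow> config d n (\<sigma> i) = rev (config d n i)"
proof -
  let ?L = "{ms. set ms \<subseteq> {..<d} \<and> length ms = n}"
  let ?g = "the_inv_into {..<d ^ n} (config d n)"
  have rev: "bij_betw rev ?L ?L" by (rule bij_betwI[where g = rev]) auto
  have bij: "bij_betw (?g \<circ> (rev \<circ> config d n)) {..<d ^ n} {..<d ^ n}"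
    using bij_betw_trans[OF bij_betw_trans[OF bij_betw_config[of d n] rev]
        bij_betw_the_inv_into[OF bij_betw_config[of d n]]] .
  have "config d n ((?g \<circ> (rev \<circ> config d n)) i) = rev (config d n i)" if "i < d ^ n" for i
  proof -
    have "config d n i \<in> ?L" using bij_betwE[OF bij_betw_config[of d n]] that by blast
    then have "rev (config d n i) \<in> ?L" by simp
    from f_the_inv_into_f_bij_betw[OF bij_betw_config[of d n]] this show ?thesis by simp
  qed
  with bij show thesis by (rule that)
qed

section \<open>Matrix words and their transposes\<close>

lemma mps_word_Nil [simp]: "mps_word \<chi> A [] = 1\<^sub>m \<chi>"
  and mps_word_Cons [simp]: "mps_word \<chi> A (m # ms) = A m * mps_word \<chi> A ms"
  by (simp_all add: mps_word_def)

lemma mps_word_carrier: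
  assumes "\<And>m. m \<in> set ms \<Longrightarrow> A m \<in> carrier_mat \<chi> \<chi>"
  shows "mps_word \<chi> A ms \<in> carrier_mat \<chi> \<chi>"
  using assms by (induct ms) (auto intro: mult_carrier_mat)

lemma mps_word_append:
  assumes "\<And>m. m \<in> set us \<union> set vs \<Longrightarrow> A m \<in> carrier_mat \<chi> \<chi>"
  shows "mps_word \<chi> A (us @ vs) = mps_word \<chi> A us * mps_word \<chi> A vs"
  using assms
proof (induct us)
  case Nil
  then show ?case using mps_word_carrier[of vs A \<chi>] by simp
next
  case (Cons m us)
  then have "A m \<in> carrier_mat \<chi> \<chi>" "mps_word \<chi> A us \<in> carrier_mat \<chi> \<chi>" "mps_word \<chi> A vs \<in> carrier_mat \<chi> \<chi>"
    by (auto intro!: mps_word_carrier)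
  then show ?case using Cons by (simp add: assoc_mult_mat[of _ \<chi> \<chi> _ \<chi> _ \<chi>])
qed

text \<open>Between neighbouring letters \<open>U * mat_adjoint U\<close> cancels, so
  \<open>U\<close> survives only at the ends and each letter leaves one \<open>c\<close>.\<close>

lemma transpose_mps_word:
  assumes A: "\<And>m. m \<in> set ms \<Longrightarrow> A m \<in> carrier_mat \<chi> \<chi>"
    and U: "unitary_mat \<chi> U"
    and At: "\<And>m. m \<in> set ms \<Longrightarrow> (A m)\<^sup>T = c \<cdot>\<^sub>m (mat_adjoint U * A m * U)"
  shows "(mps_word \<chi> A ms)\<^sup>T =
    c ^ length ms \<cdot>\<^sub>m (mat_adjoint U * mps_word \<chi> A (rev ms) * U)"
  using A At
proof (induct ms)
  case Nil
  have "U \<in> carrier_mat \<chi> \<chi>" "mat_adjoint U * U = 1\<^sub>m \<chi>" using U unfolding unitary_mat_def by auto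
  then show ?case using mat_adjoint_carrier[of U \<chi> \<chi>] by auto
next
  case (Cons m ms)
  have UC: "U \<in> carrier_mat \<chi> \<chi>" "mat_adjoint U \<in> carrier_mat \<chi> \<chi>"
    and UU: "U * mat_adjoint U = 1\<^sub>m \<chi>"
    using U mat_adjoint_carrier unfolding unitary_mat_def by auto
  define W where "W = mps_word \<chi> A (rev ms)"
  have WC: "W \<in> carrier_mat \<chi> \<chi>" "mps_word \<chi> A ms \<in> carrier_mat \<chi> \<chi>" "A m \<in> carrier_mat \<chi> \<chi>"
    unfolding W_def using Cons(2) by (auto intro!: mps_word_carrier)
  have W: "mps_word \<chi> A (rev (m # ms)) = W * A m"
    using mps_word_append[of "rev ms" "[m]" A \<chi>] Cons(2) WC(3) unfolding W_def by auto
  have ss: "a \<cdot>\<^sub>m (b \<cdot>\<^sub>m Z) = (a * b) \<cdot>\<^sub>m Z" for a b and Z :: "complex mat"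
    by (intro eq_matI) (auto simp: mult.assoc)
  have "(mps_word \<chi> A (m # ms))\<^sup>T = (mps_word \<chi> A ms)\<^sup>T * (A m)\<^sup>T"
    using WC by (simp add: transpose_mult[of _ \<chi> \<chi> _ \<chi>])
  also have "\<dots> = (c ^ length ms \<cdot>\<^sub>m (mat_adjoint U * W * U)) * (c \<cdot>\<^sub>m (mat_adjoint U * A m * U))"
    using Cons unfolding W_def by auto
  also have "\<dots> = c ^ length (m # ms) \<cdot>\<^sub>m ((mat_adjoint U * W * U) * (mat_adjoint U * A m * U))"
    using WC UC by (simp add: mult_smult_assoc_mat[of _ \<chi> \<chi> _ \<chi>] mult_smult_distrib[of _ \<chi> \<chi> _ \<chi>] ss mult.commute)
  also have "(mat_adjoint U * W * U) * (mat_adjoint U * A m * U) =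
      mat_adjoint U * W * ((U * mat_adjoint U) * (A m * U))"
    using WC UC by (simp add: assoc_mult_mat[of _ \<chi> \<chi> _ \<chi> _ \<chi>])
  also have "\<dots> = mat_adjoint U * (W * A m) * U"
    unfolding UU using WC UC by (simp add: assoc_mult_mat[of _ \<chi> \<chi> _ \<chi> _ \<chi>])
  finally show ?case unfolding W .
qed

section \<open>Amplitude matrices, partial trace and reflection\<close>

lemma set_config_subset: "i < d ^ n \<Longrightarrow> set (config d n i) \<subseteq> {..<d}"
  using bij_betwE[OF bij_betw_config[of d n]] by blast

text \<open>Basis states index the rows and bond values the columns, the other way round in
  \<open>right_amplitudes\<close>, so that their product is the coefficient matrix of the state
  across the cut.\<close>

definition left_amplitudes ::
  "nat \<Rightarrow> nat \<Rightarrow> nat \<Rightarrow> (nat \<Rightarrow> complex mat) \<Rightarrow> complex vec \<Rightarrow> complex mat" where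
  "left_amplitudes \<chi> d n A bl = mat (d ^ n) \<chi> (\<lambda>(i, \<alpha>). psi_left \<chi> d n A bl \<alpha> $ i)"

definition right_amplitudes ::
  "nat \<Rightarrow> nat \<Rightarrow> nat \<Rightarrow> (nat \<Rightarrow> complex mat) \<Rightarrow> complex vec \<Rightarrow> complex mat" where
  "right_amplitudes \<chi> d n A br = mat \<chi> (d ^ n) (\<lambda>(\<alpha>, i). psi_right \<chi> d n A br \<alpha> $ i)"

lemma left_amplitudes_carrier [simp]: "left_amplitudes \<chi> d n A bl \<in> carrier_mat (d ^ n) \<chi>"
  and right_amplitudes_carrier [simp]: "right_amplitudes \<chi> d n A br \<in> carrier_mat \<chi> (d ^ n)"
  by (simp_all add: left_amplitudes_def right_amplitudes_def)

lemma braket_sum: "dim_vec v = k \<Longrightarrow> dim_vec w = k \<Longrightarrow> braket v w = (\<Sum>i<k. cnj (v $ i) * w $ i)"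
  by (simp add: braket_def scalar_prod_def lessThan_atLeast0 conjugate_complex_def)

lemma dim_psi [simp]: "dim_vec (psi_left \<chi> d n A bl \<alpha>) = d ^ n" "dim_vec (psi_right \<chi> d n A br \<alpha>) = d ^ n"
  by (simp_all add: psi_left_def psi_right_def state_of_amplitudes_def)

lemma gram_left_eq:
  "gram_left \<chi> d n A bl = mat_adjoint (left_amplitudes \<chi> d n A bl) * left_amplitudes \<chi> d n A bl"
    (is "_ = ?R")
proof (rule eq_matI)
  fix i j assume "i < dim_row ?R" "j < dim_col ?R"
  then have ij: "i < \<chi>" "j < \<chi>" by (auto simp: left_amplitudes_def mat_adjoint_eq_transpose_cnj)
  show "gram_left \<chi> d n A bl $$ (i, j) = ?R $$ (i, j)"
    unfolding index_mat_adjoint_mult[OF left_amplitudes_carrier left_amplitudes_carrier ij]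
    using ij by (simp add: gram_left_def braket_sum left_amplitudes_def)
qed (auto simp: gram_left_def left_amplitudes_def mat_adjoint_eq_transpose_cnj)

text \<open>The bra carries the first index, so \<open>gram_right\<close> is the conjugate of this
  Hermitian product; the transpose in \<open>rho_red\<close> undoes that.\<close>

lemma transpose_gram_right_eq:
  "(gram_right \<chi> d n A br)\<^sup>T = right_amplitudes \<chi> d n A br * mat_adjoint (right_amplitudes \<chi> d n A br)"
    (is "_ = ?R")
proof (rule eq_matI)
  fix i j assume "i < dim_row ?R" "j < dim_col ?R"
  then have ij: "i < \<chi>" "j < \<chi>" by (auto simp: right_amplitudes_def mat_adjoint_eq_transpose_cnj)
  show "(gram_right \<chi> d n A br)\<^sup>T $$ (i, j) = ?R $$ (i, j)"
    unfolding index_mult_mat_adjoint[OF right_amplitudes_carrier right_amplitudes_carrier ij]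
    using ij by (simp add: gram_right_def braket_sum right_amplitudes_def mult.commute)
qed (auto simp: gram_right_def right_amplitudes_def mat_adjoint_eq_transpose_cnj)

text \<open>Splitting each word at the cut and summing over the bond index there gives \<Psi> as the
  coefficient matrix; tracing out the right factor pairs its rows with conjugated rows.\<close>

lemma partial_trace_mps_state:
  fixes \<chi> d n k :: nat and bl br :: "complex vec"
  assumes A: "\<And>m. m < d \<Longrightarrow> A m \<in> carrier_mat \<chi> \<chi>" and bl: "bl \<in> carrier_vec \<chi>" and br: "br \<in> carrier_vec \<chi>"
  defines "\<Psi> \<equiv> left_amplitudes \<chi> d n A bl * right_amplitudes \<chi> d k A br"
  shows "partial_trace_right (d ^ n) (d ^ k) (density_mat (mps_state \<chi> d (n + k) A bl br)) =
    \<Psi> * mat_adjoint \<Psi>"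
proof (rule eq_matI)
  have \<Psi>C: "\<Psi> \<in> carrier_mat (d ^ n) (d ^ k)"
    unfolding \<Psi>_def by (rule mult_carrier_mat[OF left_amplitudes_carrier right_amplitudes_carrier])
  have dim: "dim_vec (mps_state \<chi> d (n + k) A bl br) = d ^ (n + k)"
    by (simp add: mps_state_def state_of_amplitudes_def)
  have less: "i * d ^ k + j < d ^ (n + k)" if "i < d ^ n" "j < d ^ k" for i j
    using that mult_right_mono[of "Suc i" "d ^ n" "d ^ k"] by (simp add: power_add)
  have \<psi>: "mps_state \<chi> d (n + k) A bl br $ (i * d ^ k + j) = \<Psi> $$ (i, j)"
    if i: "i < d ^ n" and j: "j < d ^ k" for i j
  proof -
    define V where "V = mps_word \<chi> A (config d n i)"
    define W where "W = mps_word \<chi> A (config d k j)"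
    have VW: "V \<in> carrier_mat \<chi> \<chi>" "W \<in> carrier_mat \<chi> \<chi>"
      unfolding V_def W_def using A set_config_subset[OF i] set_config_subset[OF j] by (auto intro!: mps_word_carrier)
    have w: "W *\<^sub>v br \<in> carrier_vec \<chi>" using VW(2) br by simp
    have "mps_word \<chi> A (config d n i @ config d k j) = V * W"
      unfolding V_def W_def
      by (rule mps_word_append) (use A set_config_subset[OF i] set_config_subset[OF j] in auto)
    then have "mps_state \<chi> d (n + k) A bl br $ (i * d ^ k + j) = bl \<bullet> ((V * W) *\<^sub>v br)"
      using less[OF i j] by (simp add: mps_state_def state_of_amplitudes_def config_append[OF j])
    also have "\<dots> = bl \<bullet> (V *\<^sub>v (W *\<^sub>v br))" using VW br by simp
    also have "\<dots> = (\<Sum>\<alpha><\<chi>. (\<Sum>\<beta><\<chi>. bl $ \<alpha> * V $$ (\<alpha>, \<beta>) * (W *\<^sub>v br) $ \<beta>))"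
      using VW w by (simp add: scalar_prod_def lessThan_atLeast0 sum_distrib_left mult.assoc)
    also have "\<dots> = (\<Sum>\<beta><\<chi>. (\<Sum>\<alpha><\<chi>. bl $ \<alpha> * V $$ (\<alpha>, \<beta>)) * (W *\<^sub>v br) $ \<beta>)"
      by (subst sum.swap) (simp add: sum_distrib_right)
    also have "\<dots> = (\<Sum>\<beta><\<chi>. left_amplitudes \<chi> d n A bl $$ (i, \<beta>) * right_amplitudes \<chi> d k A br $$ (\<beta>, j))"
      using VW i j
      by (simp add: left_amplitudes_def right_amplitudes_def psi_left_def psi_right_def
          state_of_amplitudes_def V_def[symmetric] W_def[symmetric] scalar_prod_def lessThan_atLeast0)
    also have "\<dots> = \<Psi> $$ (i, j)"
      using i j unfolding \<Psi>_def
      by (simp add: left_amplitudes_def right_amplitudes_def scalar_prod_def lessThan_atLeast0)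
    finally show ?thesis .
  qed
  fix i j assume "i < dim_row (\<Psi> * mat_adjoint \<Psi>)" "j < dim_col (\<Psi> * mat_adjoint \<Psi>)"
  then have ij: "i < d ^ n" "j < d ^ n" using \<Psi>C by (auto simp: mat_adjoint_eq_transpose_cnj)
  show "partial_trace_right (d ^ n) (d ^ k) (density_mat (mps_state \<chi> d (n + k) A bl br)) $$ (i, j) =
      (\<Psi> * mat_adjoint \<Psi>) $$ (i, j)"
    unfolding index_mult_mat_adjoint[OF \<Psi>C \<Psi>C ij]
    using ij by (simp add: partial_trace_right_def density_mat_def dim less \<psi>)
qed (auto simp: partial_trace_right_def \<Psi>_def left_amplitudes_def mat_adjoint_eq_transpose_cnj)

text \<open>\<open>bl\<close> contracted with a word is the transposed word applied to
  \<open>bl\<close>, that is \<open>mat_adjoint U * W * U\<close> up to phase, with \<open>W\<close>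
  the reversed word. Here \<open>U\<close> takes \<open>bl\<close> back to \<open>br\<close>,
  leaving a right amplitude, and the outer \<open>mat_adjoint U\<close> is the transpose of
  \<open>map_mat cnj U\<close>.\<close>

lemma left_amplitudes_reflected:
  assumes A: "\<And>m. m < d \<Longrightarrow> A m \<in> carrier_mat \<chi> \<chi>" and br: "br \<in> carrier_vec \<chi>"
    and U: "unitary_mat \<chi> U"
    and At: "\<And>m. m < d \<Longrightarrow> (A m)\<^sup>T = c \<cdot>\<^sub>m (mat_adjoint U * A m * U)"
    and bl: "mat_adjoint U *\<^sub>v br = bl"
    and i: "i < d ^ n" and i': "i' < d ^ n" "config d n i' = rev (config d n i)" and \<alpha>: "\<alpha> < \<chi>"
  shows "left_amplitudes \<chi> d n A bl $$ (i, \<alpha>) =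
    c ^ n * ((right_amplitudes \<chi> d n A br)\<^sup>T * map_mat cnj U) $$ (i', \<alpha>)"
proof -
  define V where "V = mps_word \<chi> A (config d n i)"
  define W where "W = mps_word \<chi> A (config d n i')"
  have VW: "V \<in> carrier_mat \<chi> \<chi>" "W \<in> carrier_mat \<chi> \<chi>"
    unfolding V_def W_def using A set_config_subset[OF i] i'(2) by (auto intro!: mps_word_carrier)
  have UC: "U \<in> carrier_mat \<chi> \<chi>" "mat_adjoint U \<in> carrier_mat \<chi> \<chi>"
    and UU: "U * mat_adjoint U = 1\<^sub>m \<chi>"
    using U mat_adjoint_carrier unfolding unitary_mat_def by auto
  have blC: "bl \<in> carrier_vec \<chi>" using UC br bl by auto
  have Vt: "V\<^sup>T = c ^ n \<cdot>\<^sub>m (mat_adjoint U * W * U)"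
    unfolding V_def W_def i'(2)
    using transpose_mps_word[of "config d n i" A \<chi> U c] U A At set_config_subset[OF i] by auto
  have "left_amplitudes \<chi> d n A bl $$ (i, \<alpha>) = bl \<bullet> col V \<alpha>"
    using i \<alpha> by (simp add: left_amplitudes_def psi_left_def state_of_amplitudes_def V_def)
  also have "\<dots> = (V\<^sup>T *\<^sub>v bl) $ \<alpha>"
    using VW \<alpha> blC by (simp add: comm_scalar_prod[of bl \<chi>])
  also have "V\<^sup>T *\<^sub>v bl = c ^ n \<cdot>\<^sub>v ((mat_adjoint U * W * U) *\<^sub>v bl)"
    unfolding Vt using UC VW blC by (intro eq_vecI) auto
  also have "(mat_adjoint U * W * U) *\<^sub>v bl = mat_adjoint U *\<^sub>v (W *\<^sub>v ((U * mat_adjoint U) *\<^sub>v br))"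
    unfolding bl[symmetric] using UC VW br by (simp add: assoc_mult_mat_vec[of _ \<chi> \<chi> _ \<chi>])
  also have "(U * mat_adjoint U) *\<^sub>v br = br" unfolding UU using br by simp
  also have "(c ^ n \<cdot>\<^sub>v (mat_adjoint U *\<^sub>v (W *\<^sub>v br))) $ \<alpha> =
      c ^ n * (\<Sum>\<beta><\<chi>. (W *\<^sub>v br) $ \<beta> * cnj (U $$ (\<beta>, \<alpha>)))"
    using UC VW br \<alpha>
    by (simp add: mat_adjoint_eq_transpose_cnj scalar_prod_def lessThan_atLeast0 mult.commute)
  also have "(\<Sum>\<beta><\<chi>. (W *\<^sub>v br) $ \<beta> * cnj (U $$ (\<beta>, \<alpha>))) =
      ((right_amplitudes \<chi> d n A br)\<^sup>T * map_mat cnj U) $$ (i', \<alpha>)"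
    using UC VW \<alpha> i'(1)
    by (simp add: right_amplitudes_def psi_right_def state_of_amplitudes_def W_def[symmetric]
        scalar_prod_def lessThan_atLeast0)
  finally show ?thesis .
qed

section \<open>Even multiplicities in both spectra\<close>

theorem mainTheorem3:
  fixes \<chi> d n :: nat
    and A :: "nat \<Rightarrow> complex mat"
    and bl br :: "complex vec"
    and U :: "complex mat"
    and \<theta> :: real
  assumes "n \<ge> 1"
    and "\<And>m. m < d \<Longrightarrow> A m \<in> carrier_mat \<chi> \<chi>"
    and "bl \<in> carrier_vec \<chi>"
    and "br \<in> carrier_vec \<chi>"
    and "unitary_mat \<chi> U"
    and "\<And>m. m < d \<Longrightarrow> (A m)\<^sup>T = cis \<theta> \<cdot>\<^sub>m (mat_adjoint U * A m * U)"
    and "mat_adjoint U *\<^sub>v br = bl"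
    and "U * map_mat cnj U = - 1\<^sub>m \<chi>"
  shows "(\<forall>x. eigenvalue (rho_red \<chi> d n A bl br) x \<longrightarrow>
            even (order x (char_poly (rho_red \<chi> d n A bl br)))) \<and>
         (mps_state \<chi> d (2 * n) A bl br \<noteq> 0\<^sub>v (d ^ (2 * n)) \<longrightarrow>
            (\<forall>\<epsilon> \<in># entanglement_spectrum d n n (mps_state \<chi> d (2 * n) A bl br).
               2 \<le> count (entanglement_spectrum d n n (mps_state \<chi> d (2 * n) A bl br)) \<epsilon>))"
proof -
  note A = assms(2) and bl = assms(3) and br = assms(4) and U = assms(5) and At = assms(6)
  define P where "P = left_amplitudes \<chi> d n A bl"
  define Q where "Q = right_amplitudes \<chi> d n A br"
  define X where "X = map_mat cnj U"
  define M where "M = Q\<^sup>T * X * Q"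
  define \<rho> where "\<rho> = rho_red \<chi> d n A bl br"
  define D where "D = partial_trace_right (d ^ n) (d ^ n) (density_mat (mps_state \<chi> d (2 * n) A bl br))"
  have P: "P \<in> carrier_mat (d ^ n) \<chi>" and Q: "Q \<in> carrier_mat \<chi> (d ^ n)"
    by (simp_all add: P_def Q_def)
  have P': "mat_adjoint P \<in> carrier_mat \<chi> (d ^ n)" and Q': "mat_adjoint Q \<in> carrier_mat (d ^ n) \<chi>"
    using P Q mat_adjoint_carrier by auto
  have UC: "U \<in> carrier_mat \<chi> \<chi>" "mat_adjoint U \<in> carrier_mat \<chi> \<chi>"
    and UU: "mat_adjoint U * U = 1\<^sub>m \<chi>"
    using U mat_adjoint_carrier unfolding unitary_mat_def by auto
  have X: "X \<in> carrier_mat \<chi> \<chi>" using UC by (simp add: X_def)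
  have M: "M \<in> carrier_mat (d ^ n) (d ^ n)" using Q X unfolding M_def by simp
  have M': "mat_adjoint M \<in> carrier_mat (d ^ n) (d ^ n)" using M by (rule mat_adjoint_carrier)
  have UX: "U * X = - 1\<^sub>m \<chi>" using assms(8) by (simp add: X_def)
  \<comment> \<open>Multiplying \<open>U * X = - 1\<close> by \<open>mat_adjoint U\<close>, which is
    the transpose of \<open>X\<close>, gives antisymmetry.\<close>
  have "X = (mat_adjoint U * U) * X" unfolding UU using X by simp
  also have "\<dots> = mat_adjoint U * (U * X)" using UC X by simp
  also have "\<dots> = - mat_adjoint U" unfolding UX using UC by simp
  also have "\<dots> = - X\<^sup>T" by (simp add: X_def mat_adjoint_eq_transpose_cnj)
  finally have "- X = - (- X\<^sup>T)" by simp
  then have Xt: "X\<^sup>T = - X" by simp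
  have "det U * det X \<noteq> 0"
  proof -
    have "- 1\<^sub>m \<chi> = (- 1) \<cdot>\<^sub>m (1\<^sub>m \<chi> :: complex mat)" by (intro eq_matI) auto
    then show ?thesis
      unfolding det_mult[OF UC(1) X, symmetric] UX by (simp add: det_smult)
  qed
  then have "even \<chi>" using even_dim_invertible_antisymmetric[OF X Xt] by auto
  have Mt: "M\<^sup>T = - M" unfolding M_def by (rule antisymmetric_congruence[OF Q X Xt])
  obtain \<sigma> where \<sigma>: "bij_betw \<sigma> {..<d ^ n} {..<d ^ n}"
    "\<And>i. i < d ^ n \<Longrightarrow> config d n (\<sigma> i) = rev (config d n i)"
    by (rule config_rev_permutation[of d n]) blast
  \<comment> \<open>By reflection, \<open>P\<close> is \<open>Q\<^sup>T * X\<close> with rows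
    permuted and a phase, so the Gram matrices agree; multiplying by \<open>Q\<close> turns this
    into the Gram matrix of \<open>M\<close>.\<close>
  have "mat_adjoint P * P = mat_adjoint (Q\<^sup>T * X) * (Q\<^sup>T * X)"
  proof (rule gram_phase_permuted_rows[OF _ P \<sigma>(1)])
    fix i \<alpha> assume "i < d ^ n" "\<alpha> < \<chi>"
    moreover from this have "\<sigma> i < d ^ n" using bij_betwE[OF \<sigma>(1)] by auto
    ultimately show "P $$ (i, \<alpha>) = cis \<theta> ^ n * (Q\<^sup>T * X) $$ (\<sigma> i, \<alpha>)"
      unfolding P_def Q_def X_def
      by (intro left_amplitudes_reflected[OF A br U At assms(7)] \<sigma>(2))
  qed (use Q X in \<open>auto simp: norm_power\<close>)
  then have gram: "mat_adjoint (P * Q) * (P * Q) = mat_adjoint M * M"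
    using gram_mult[OF P Q] gram_mult[of "Q\<^sup>T * X" "d ^ n" \<chi> Q "d ^ n"] Q X
    unfolding M_def by simp
  have M't: "(mat_adjoint M)\<^sup>T = - mat_adjoint M"
  proof -
    have "mat_adjoint M = map_mat cnj (M\<^sup>T)"
      unfolding mat_adjoint_eq_transpose_cnj by (intro eq_matI) auto
    also have "\<dots> = - map_mat cnj M" unfolding Mt by (intro eq_matI) auto
    finally have "- mat_adjoint M = map_mat cnj M" by simp
    moreover have "(mat_adjoint M)\<^sup>T = map_mat cnj M" by (simp add: mat_adjoint_eq_transpose_cnj)
    ultimately show ?thesis by simp
  qed
  \<comment> \<open>The scalar lets one statement serve \<open>rho_red\<close>, with
    \<open>c = 1\<close>, and the trace-normalized density matrix.\<close>
  have smult: "even (order x (char_poly ((c \<cdot>\<^sub>m mat_adjoint (P * Q)) * (P * Q))))" if "x \<noteq> 0" for c x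
  proof -
    have PQ: "P * Q \<in> carrier_mat (d ^ n) (d ^ n)" using P Q by simp
    have "(c \<cdot>\<^sub>m mat_adjoint (P * Q)) * (P * Q) = (c \<cdot>\<^sub>m mat_adjoint M) * M"
      using gram M M' PQ mat_adjoint_carrier[OF PQ]
      by (simp add: mult_smult_assoc_mat[of _ "d ^ n" "d ^ n" _ "d ^ n"])
    moreover have "(c \<cdot>\<^sub>m mat_adjoint M)\<^sup>T = - (c \<cdot>\<^sub>m mat_adjoint M)"
    proof -
      have "(c \<cdot>\<^sub>m mat_adjoint M)\<^sup>T = c \<cdot>\<^sub>m (mat_adjoint M)\<^sup>T" by (intro eq_matI) auto
      then show ?thesis unfolding M't by (auto intro!: eq_matI)
    qed
    ultimately show ?thesis
      using even_order_char_poly_mult_antisymmetric[of "c \<cdot>\<^sub>m mat_adjoint M" "d ^ n" M x] M M' Mt that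
      by simp
  qed
  have \<rho>: "\<rho> = (mat_adjoint P * P * Q) * mat_adjoint Q"
    unfolding \<rho>_def rho_red_def gram_left_eq transpose_gram_right_eq P_def[symmetric] Q_def[symmetric]
    by (rule assoc_mult_mat[symmetric]) (use P P' Q Q' in auto)
  have PPQ: "mat_adjoint P * P * Q \<in> carrier_mat \<chi> (d ^ n)"
    by (rule mult_carrier_mat[OF mult_carrier_mat[OF P' P] Q])
  have \<rho>C: "\<rho> \<in> carrier_mat \<chi> \<chi>" unfolding \<rho> by (rule mult_carrier_mat[OF PPQ Q'])
  have "even (order x (char_poly \<rho>))" if "x \<noteq> 0" for x
  proof -
    \<comment> \<open>Moving \<open>mat_adjoint Q\<close> to the front gives the Gram matrix of
      \<open>P * Q\<close>.\<close>
    have "order x (char_poly \<rho>) = order x (char_poly (mat_adjoint Q * (mat_adjoint P * P * Q)))"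
      unfolding \<rho> by (rule order_char_poly_swap[OF PPQ Q' that])
    also have "mat_adjoint Q * (mat_adjoint P * P * Q) = (1 \<cdot>\<^sub>m mat_adjoint (P * Q)) * (P * Q)"
    proof -
      have "1 \<cdot>\<^sub>m Z = Z" for Z :: "complex mat" by (intro eq_matI) auto
      then show ?thesis
        using P P' Q Q' unfolding mat_adjoint_mult[OF P Q]
        by (simp add: assoc_mult_mat[of _ "d ^ n" \<chi> _ "d ^ n" _ "d ^ n"]
            assoc_mult_mat[of _ \<chi> "d ^ n" _ \<chi> _ "d ^ n"])
    qed
    finally show ?thesis using smult[OF that, of 1] by (simp only:)
  qed
  \<comment> \<open>The degree is \<chi>, and its parity settles the eigenvalue 0.\<close>
  moreover have "even (degree (char_poly \<rho>))"
    using degree_monic_char_poly[OF \<rho>C] \<open>even \<chi>\<close> by metis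
  ultimately have part1: "even (order x (char_poly \<rho>))" for x
    using even_order_from_nonzero_roots[OF char_poly_nonzero[OF \<rho>C]] by blast
  have D: "D = P * Q * mat_adjoint (P * Q)"
    using partial_trace_mps_state[where n = n and k = n, OF A bl br] unfolding D_def P_def Q_def by (simp add: mult_2)
  define c where "c = 1 / (\<Sum>i<dim_row D. D $$ (i, i))"
  have PQ: "P * Q \<in> carrier_mat (d ^ n) (d ^ n)" using P Q by simp
  note PQ' = mat_adjoint_carrier[OF PQ]
  have "trace_normalized D = c \<cdot>\<^sub>m D" by (simp add: trace_normalized_def c_def)
  \<comment> \<open>The scalar goes to the adjoint factor, so that after a cyclic swap
    \<open>smult\<close> applies.\<close>
  also have "\<dots> = (P * Q) * (c \<cdot>\<^sub>m mat_adjoint (P * Q))"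
    unfolding D by (rule mult_smult_distrib[OF PQ PQ', symmetric])
  finally have tD: "trace_normalized D = (P * Q) * (c \<cdot>\<^sub>m mat_adjoint (P * Q))" .
  have DC: "trace_normalized D \<in> carrier_mat (d ^ n) (d ^ n)"
    unfolding tD by (rule mult_carrier_mat[OF PQ smult_carrier_mat[OF PQ']])
  have "even (order x (char_poly (trace_normalized D)))" if "x \<noteq> 0" for x
    unfolding tD order_char_poly_swap[OF PQ smult_carrier_mat[OF PQ'] that] by (rule smult[OF that])
  moreover note char_poly_nonzero[OF DC]
  \<comment> \<open>Only nonzero eigenvalues enter the entanglement spectrum, so their even orders
    suffice.\<close>
  ultimately have "2 \<le> count (entanglement_spectrum d n n (mps_state \<chi> d (2 * n) A bl br)) \<epsilon>"
    if "\<epsilon> \<in># entanglement_spectrum d n n (mps_state \<chi> d (2 * n) A bl br)" for \<epsilon>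
    using that unfolding entanglement_spectrum_def D_def[symmetric]
    by (intro two_le_count_image_mset_nonzero_proots)
  with part1 show ?thesis unfolding \<rho>_def by blast
qed

end
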